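(* Let $g$ be analytic in the unit disc $\mathbb{D}$. Then the operator $\mathcal{H}_g$ is bounded from $H^\infty$ to the Bloch space $\mathcal{B}$ if and only if $g\in\mathcal{B}$.
   Context: $\mathbb{D}$ is the open unit disc of $\mathbb{C}$ and $H(\mathbb{D})$ is the space of all analytic functions in $\mathbb{D}$. For $g\in H(\mathbb{D})$ the generalized Hilbert operator is $\mathcal{H}_g(f)(z)=\int_0^1 f(t)g'(tz)\,dt$, $z\in\mathbb{D}$. $H^\infty$ is the space of bounded analytic functions in $\mathbb{D}$ with the sup norm. The Bloch space $\mathcal{B}$ is the space of $f\in H(\mathbb{D})$ with $\|f\|_{\mathcal{B}}=|f(0)|+\sup_{z\in\mathbb{D}}(1-|z|^2)|f'(z)|<\infty$. *)

theory Defs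
  imports "HOL-Complex_Analysis.Complex_Analysis"
begin

text \<open>
  A function on the unit disc is represented by a total function on the complex plane; all notions
  below depend only on its values in \<^term>\<open>ball 0 1 :: complex set\<close>.
\<close>

abbreviation unit_disc :: "complex set" (\<open>\<bbbD>\<close>)
  where "\<bbbD> \<equiv> ball 0 1"

definition H_infty :: "(complex \<Rightarrow> complex) set"
  where "H_infty = {f. f holomorphic_on \<bbbD> \<and> bounded (f ` \<bbbD>)}"

definition H_infty_norm :: "(complex \<Rightarrow> complex) \<Rightarrow> real"
  where "H_infty_norm f = (SUP z\<in>\<bbbD>. norm (f z))"

text \<open>
  A real supremum is meaningful only over a bounded set, so finiteness of the Bloch norm
  is expressed by \<^const>\<open>bdd_above\<close>.
\<close>

definition bloch_space :: "(complex \<Rightarrow> complex) set"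
  where "bloch_space =
    {f. f holomorphic_on \<bbbD> \<and> bdd_above ((\<lambda>z. (1 - (norm z)\<^sup>2) * norm (deriv f z)) ` \<bbbD>)}"

definition bloch_norm :: "(complex \<Rightarrow> complex) \<Rightarrow> real"
  where "bloch_norm f = norm (f 0) + (SUP z\<in>\<bbbD>. (1 - (norm z)\<^sup>2) * norm (deriv f z))"

text \<open>
  The endpoint \<open>t = 1\<close>, where \<open>f\<close> need not be defined, is left out of the domain of integration.
\<close>

definition hilbert_op :: "(complex \<Rightarrow> complex) \<Rightarrow> (complex \<Rightarrow> complex) \<Rightarrow> complex \<Rightarrow> complex"
  where "hilbert_op g f z =
    (LINT t:{0..<1::real}|lborel. f (of_real t) * deriv g (of_real t * z))"

definition bounded_operator ::
  "'a set \<Rightarrow> ('a \<Rightarrow> real) \<Rightarrow> 'b set \<Rightarrow> ('b \<Rightarrow> real) \<Rightarrow> ('a \<Rightarrow> 'b) \<Rightarrow> bool"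
  where "bounded_operator X normX Y normY T \<longleftrightarrow>
    (\<forall>f\<in>X. T f \<in> Y) \<and> (\<exists>C. \<forall>f\<in>X. normY (T f) \<le> C * normX f)"

end

theory Submission
  imports Defs
begin

text \<open>
  If \<open>g\<close> is a Bloch function, then Cauchy's inequality for \<open>g'\<close> on a circle of radius
  \<open>(1 - |w|) / 2\<close> gives \<open>|g''(w)| \<le> 4 M / (1 - |w|)\<^sup>2\<close>. Differentiating under the integral sign and
  integrating this bound, \<open>|(H\<^sub>g f)'(z)| \<le> 4 M \<parallel>f\<parallel> \<integral>\<^sub>0\<^sup>1 (1 - t|z|)\<^sup>-\<^sup>2 dt = 4 M \<parallel>f\<parallel> / (1 - |z|)\<close>.
  Conversely \<open>z H\<^sub>g 1 (z) = g(z) - g(0)\<close>, and the product of the identity with the Bloch function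
  \<open>H\<^sub>g 1\<close> is again a Bloch function.
\<close>

section \<open>Integrability and norm bounds on the half-open unit interval\<close>

lemma norm_of_real_mult_le:
  fixes z :: complex
  assumes "0 \<le> t" "t \<le> 1"
  shows "norm (of_real t * z) \<le> norm z"
  using assms by (simp add: norm_mult mult_left_le_one_le)

text \<open>Continuity on a Borel set gives measurability, and a bounded function on a set of finite
  measure is integrable. Nothing is asked at t = 1, where the integrand may have no limit.\<close>

lemma set_integrable_bounded_continuous:
  fixes \<phi> :: "real \<Rightarrow> complex"
  assumes "continuous_on {0..<1} \<phi>" "\<And>t. t \<in> {0..<1} \<Longrightarrow> norm (\<phi> t) \<le> B"
  shows "set_integrable lborel {0..<1} \<phi>"
  unfolding set_integrable_def
proof (rule integrableI_bounded_set[where A = "{0..<1}" and B = B])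
  show "(\<lambda>t. indicator {0..<1} t *\<^sub>R \<phi> t) \<in> borel_measurable lborel"
    using borel_measurable_continuous_on_indicator[OF _ assms(1)] by simp
qed (use assms in auto)

text \<open>The majorant, unlike \<open>\<phi>\<close>, is continuous up to t = 1, and one point has
  measure zero. So the integral of \<open>b\<close> may be taken over the closed interval, where the
  fundamental theorem of calculus evaluates it.\<close>

lemma norm_set_integral_le_antiderivative:
  fixes \<phi> :: "real \<Rightarrow> complex" and b B :: "real \<Rightarrow> real"
  assumes \<phi>: "set_integrable lborel {0..<1} \<phi>"
    and le: "\<And>t. t \<in> {0..<1} \<Longrightarrow> norm (\<phi> t) \<le> b t"
    and B: "\<And>t. t \<in> {0..1} \<Longrightarrow> (B has_real_derivative b t) (at t within {0..1})"
    and b: "continuous_on {0..1} b"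
  shows "norm (LINT t:{0..<1}|lborel. \<phi> t) \<le> B 1 - B 0"
proof -
  have "has_bochner_integral lborel (\<lambda>x. indicator {0..1} x *\<^sub>R b x) (B 1 - B 0)"
    by (rule has_bochner_integral_FTC_Icc)
       (use B b in \<open>auto simp flip: has_real_derivative_iff_has_vector_derivative\<close>)
  hence int: "set_integrable lborel {0..1} b" and eq: "(LINT t:{0..1}|lborel. b t) = B 1 - B 0"
    unfolding set_integrable_def set_lebesgue_integral_def
    by (auto simp: has_bochner_integral_iff)
  have int': "set_integrable lborel {0..<1} b"
    by (rule set_integrable_subset[OF int]) auto
  have "norm (LINT t:{0..<1}|lborel. \<phi> t) \<le> (LINT t:{0..<1}|lborel. norm (\<phi> t))"
    by (rule set_integral_norm_bound[OF \<phi>])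
  also have "\<dots> \<le> (LINT t:{0..<1}|lborel. b t)"
    by (rule set_integral_mono) (use \<phi> int' le in \<open>auto intro: set_integrable_norm\<close>)
  also have "\<dots> = (LINT t:{0..1}|lborel. b t)"
    by (rule set_integral_discrete_difference[where X = "{1}"]) auto
  finally show ?thesis
    using eq by simp
qed

lemma norm_set_integral_le_const:
  fixes \<phi> :: "real \<Rightarrow> complex"
  assumes "set_integrable lborel {0..<1} \<phi>" "\<And>t. t \<in> {0..<1} \<Longrightarrow> norm (\<phi> t) \<le> C"
  shows "norm (LINT t:{0..<1}|lborel. \<phi> t) \<le> C"
proof -
  have "norm (LINT t:{0..<1}|lborel. \<phi> t) \<le> C * 1 - C * 0"
    by (rule norm_set_integral_le_antiderivative[where b = "\<lambda>_. C"])
       (use assms in \<open>auto intro!: derivative_eq_intros\<close>)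
  thus ?thesis by simp
qed

section \<open>Differentiation under the integral sign\<close>

text \<open>For fixed z all points tz lie in the compact disc of radius |z|, where \<open>G\<close>
  is bounded; the integrand is therefore continuous and bounded.\<close>

lemma set_integrable_weighted_dilation:
  fixes \<phi> :: "real \<Rightarrow> complex"
  assumes \<phi>: "continuous_on {0..<1} \<phi>" "\<And>t. t \<in> {0..<1} \<Longrightarrow> norm (\<phi> t) \<le> F"
    and G: "continuous_on \<bbbD> G" and z: "z \<in> \<bbbD>"
  shows "set_integrable lborel {0..<1} (\<lambda>t. \<phi> t * G (of_real t * z))"
proof -
  have sub: "cball 0 (norm z) \<subseteq> \<bbbD>"
    using z by auto
  have "compact (G ` cball 0 (norm z))"
    by (intro compact_continuous_image continuous_on_subset[OF G sub]) auto
  then obtain K where K: "\<And>w. w \<in> cball 0 (norm z) \<Longrightarrow> norm (G w) \<le> K"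
    by (meson bounded_iff compact_imp_bounded imageI)
  have F: "0 \<le> F"
    using order_trans[OF norm_ge_zero \<phi>(2)[of 0]] by simp
  show ?thesis
  proof (rule set_integrable_bounded_continuous[where B = "F * K"])
    have "(\<lambda>t. of_real t * z) ` {0..<1} \<subseteq> \<bbbD>"
      using sub norm_of_real_mult_le[of _ z] by fastforce
    thus "continuous_on {0..<1} (\<lambda>t. \<phi> t * G (of_real t * z))"
      by (intro continuous_intros \<phi>(1) continuous_on_compose2[OF G])
    show "norm (\<phi> t * G (of_real t * z)) \<le> F * K" if "t \<in> {0..<1}" for t
      unfolding norm_mult
      by (intro mult_mono \<phi> K) (use that F norm_of_real_mult_le[of t z] in auto)
  qed
qed

text \<open>The first-order Taylor remainder of \<open>G\<close> is quadratic, with a constant that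
  is uniform on a compact disc and hence uniform in t. Integrating it leaves an error of order |w -
  z|^2. The lemma is meant for \<open>G\<close> = \<open>deriv g\<close> and \<open>\<phi>\<close>
  the restriction of f to the radius.\<close>

lemma has_field_derivative_weighted_dilation:
  fixes \<phi> :: "real \<Rightarrow> complex"
  assumes \<phi>: "continuous_on {0..<1} \<phi>" "\<And>t. t \<in> {0..<1} \<Longrightarrow> norm (\<phi> t) \<le> F"
    and G: "G holomorphic_on \<bbbD>" and z: "z \<in> \<bbbD>"
  shows "((\<lambda>z. LINT t:{0..<1}|lborel. \<phi> t * G (of_real t * z)) has_field_derivative
    (LINT t:{0..<1}|lborel. \<phi> t * of_real t * deriv G (of_real t * z))) (at z)"
    (is "(?H has_field_derivative ?D) _")
proof -
  \<comment> \<open>Halfway between |z| and 1: \<open>cball 0 R\<close> is compact in the disc and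
    still contains a neighbourhood of z.\<close>
  define R where "R = (1 + norm z) / 2"
  have R: "norm z < R" "R < 1"
    using z by (auto simp: R_def)
  have sub: "cball 0 R \<subseteq> \<bbbD>"
    using R by auto
  have hol: "(deriv ^^ n) G holomorphic_on \<bbbD>" for n
    by (intro holomorphic_higher_deriv G) auto
  have hol1: "deriv G holomorphic_on \<bbbD>"
    using hol[of 1] by simp
  have "compact ((deriv ^^ 2) G ` cball 0 R)"
    by (intro compact_continuous_image holomorphic_on_imp_continuous_on
        holomorphic_on_subset[OF hol sub]) auto
  then obtain K where K: "\<And>w. w \<in> cball 0 R \<Longrightarrow> norm ((deriv ^^ 2) G w) \<le> K"
    by (meson bounded_iff compact_imp_bounded imageI)
  have K0: "0 \<le> K"
    using order_trans[OF norm_ge_zero K[of 0]] order_trans[OF norm_ge_zero less_imp_le[OF R(1)]]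
    by simp
  have F: "0 \<le> F"
    using order_trans[OF norm_ge_zero \<phi>(2)[of 0]] by simp
  have taylor: "norm (G w - G v - deriv G v * (w - v)) \<le> K * norm (w - v) ^ 2"
    if "v \<in> cball 0 R" "w \<in> cball 0 R" for v w
  proof -
    have "norm ((deriv ^^ 0) G w - (\<Sum>i\<le>1. (deriv ^^ i) G v * (w - v) ^ i / fact i))
        \<le> K * norm (w - v) ^ Suc 1 / fact 1"
    proof (rule complex_Taylor[of "cball 0 R"])
      fix i :: nat and x :: complex assume "x \<in> cball 0 R"
      hence "x \<in> \<bbbD>" using sub by blast
      thus "((deriv ^^ i) G has_field_derivative (deriv ^^ Suc i) G x) (at x within cball 0 R)"
        using holomorphic_derivI[OF hol[of i] open_ball] by simp
    qed (use that K in \<open>auto simp: numeral_2_eq_2\<close>)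
    thus ?thesis
      by (simp add: numeral_2_eq_2 algebra_simps)
  qed
  have \<phi>t: "continuous_on {0..<1} (\<lambda>t. \<phi> t * of_real t)"
    by (intro continuous_intros \<phi>(1))
  have \<phi>t_le: "norm (\<phi> t * of_real t) \<le> F" if "t \<in> {0..<1}" for t
    using mult_mono[OF \<phi>(2)[OF that], of "\<bar>t\<bar>" 1] that F by (simp add: norm_mult)
  \<comment> \<open>Multiplication by t keeps w and z inside \<open>cball 0 R\<close> and does not
    increase their distance, so \<open>taylor\<close> applies to tw and tz for every t with the same
    \<open>K\<close>.\<close>
  have est: "norm (?H w - ?H z - ?D * (w - z)) \<le> F * K * norm (w - z) ^ 2"
    if w: "w \<in> cball 0 R" for w
  proof -
    have wD: "w \<in> \<bbbD>" and zR: "z \<in> cball 0 R"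
      using w sub R by auto
    have int: "set_integrable lborel {0..<1} (\<lambda>t. \<phi> t * G (of_real t * v))" if "v \<in> \<bbbD>" for v
      by (rule set_integrable_weighted_dilation[OF \<phi> holomorphic_on_imp_continuous_on[OF G] that])
    have int': "set_integrable lborel {0..<1} (\<lambda>t. \<phi> t * of_real t * deriv G (of_real t * z))"
      by (rule set_integrable_weighted_dilation[OF \<phi>t \<phi>t_le
            holomorphic_on_imp_continuous_on[OF hol1] z])
    let ?I = "\<lambda>t. \<phi> t * G (of_real t * w) - \<phi> t * G (of_real t * z)
      - \<phi> t * of_real t * deriv G (of_real t * z) * (w - z)"
    have intI: "set_integrable lborel {0..<1} ?I"
      by (intro set_integral_diff(1) set_integrable_mult_left int int' wD z)
    have "?H w - ?H z - ?D * (w - z) = (LINT t:{0..<1}|lborel. ?I t)"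
      using int[OF wD] int[OF z] int' by (simp add: set_integral_diff)
    moreover have "norm (LINT t:{0..<1}|lborel. ?I t) \<le> F * K * norm (w - z) ^ 2"
    proof (rule norm_set_integral_le_const[OF intI])
      fix t :: real assume t: "t \<in> {0..<1}"
      have "?I t = \<phi> t * (G (of_real t * w) - G (of_real t * z)
          - deriv G (of_real t * z) * (of_real t * w - of_real t * z))"
        by (simp add: algebra_simps)
      also have "norm \<dots> \<le> F * (K * norm (of_real t * w - of_real t * z) ^ 2)"
        unfolding norm_mult[of "\<phi> t"]
        by (intro mult_mono \<phi> taylor)
          (use t F w zR norm_of_real_mult_le[of t z] norm_of_real_mult_le[of t w] in auto)
      also have "norm (of_real t * w - of_real t * z) \<le> norm (w - z)"
        using norm_of_real_mult_le[of t "w - z"] t by (simp add: algebra_simps)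
      hence "F * (K * norm (of_real t * w - of_real t * z) ^ 2) \<le> F * (K * norm (w - z) ^ 2)"
        by (intro mult_left_mono power_mono F K0) auto
      finally show "norm (?I t) \<le> F * K * norm (w - z) ^ 2"
        by (simp add: mult.assoc)
    qed
    ultimately show ?thesis by simp
  qed
  \<comment> \<open>Division of \<open>est\<close> by w - z leaves one factor |w - z|, which tends
    to 0.\<close>
  have "((\<lambda>w. (?H w - ?H z) / (w - z) - ?D) \<longlongrightarrow> 0) (at z)"
  proof (rule Lim_null_comparison)
    show "((\<lambda>w. F * K * norm (w - z)) \<longlongrightarrow> 0) (at z)"
      by (auto intro!: tendsto_eq_intros)
    have "\<forall>\<^sub>F w in at z. w \<in> ball 0 R - {z}"
      by (rule eventually_at_in_open) (use R in auto)
    thus "\<forall>\<^sub>F w in at z. norm ((?H w - ?H z) / (w - z) - ?D) \<le> F * K * norm (w - z)"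
    proof eventually_elim
      case (elim w)
      have "(?H w - ?H z) / (w - z) - ?D = (?H w - ?H z - ?D * (w - z)) / (w - z)"
        using elim by (simp add: diff_divide_distrib)
      also have "norm \<dots> \<le> F * K * norm (w - z) ^ 2 / norm (w - z)"
        unfolding norm_divide using elim by (intro divide_right_mono est) auto
      finally show ?case
        using elim by (simp add: power2_eq_square)
    qed
  qed
  thus ?thesis
    unfolding has_field_derivative_iff by (rule Lim_null[THEN iffD2])
qed

section \<open>Bloch symbols give bounded operators\<close>

text \<open>With \<rho> = (1 - |w|)/2, every u on the circle of radius \<rho> about w satisfies 1 -
  |u|^2 \<ge> 1 - |u| \<ge> \<rho>, so |g'(u)| \<le> M/\<rho>. Cauchy's inequality divides by \<rho>
  once more, and M/\<rho>^2 produces the factor 4.\<close>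

lemma bloch_second_deriv_bound:
  assumes g: "g holomorphic_on \<bbbD>"
    and M: "\<And>z. z \<in> \<bbbD> \<Longrightarrow> (1 - (norm z)\<^sup>2) * norm (deriv g z) \<le> M"
    and w: "w \<in> \<bbbD>"
  shows "norm (deriv (deriv g) w) \<le> 4 * M / (1 - norm w)\<^sup>2"
proof -
  define \<rho> where "\<rho> = (1 - norm w) / 2"
  have \<rho>: "0 < \<rho>" "norm w + 2 * \<rho> = 1"
    using w by (auto simp: \<rho>_def field_simps)
  have in_disc: "u \<in> \<bbbD>" "\<rho> \<le> 1 - norm u" if "norm (w - u) \<le> \<rho>" for u
    using norm_triangle_ineq3[of w u] that \<rho> by auto
  have sub: "cball w \<rho> \<subseteq> \<bbbD>"
    using in_disc(1) by (auto simp: dist_norm)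
  have hol: "deriv g holomorphic_on \<bbbD>"
    by (intro holomorphic_deriv g) auto
  have "norm ((deriv ^^ 1) (deriv g) w) \<le> fact 1 * (M / \<rho>) / \<rho> ^ 1"
  proof (rule Cauchy_inequality)
    show "deriv g holomorphic_on ball w \<rho>"
      by (rule holomorphic_on_subset[OF hol]) (use sub in auto)
    show "continuous_on (cball w \<rho>) (deriv g)"
      by (rule holomorphic_on_imp_continuous_on[OF holomorphic_on_subset[OF hol sub]])
    fix u assume "norm (w - u) = \<rho>"
    hence u: "u \<in> \<bbbD>" "\<rho> \<le> 1 - norm u"
      using in_disc[of u] by auto
    have "norm u * norm u \<le> norm u * 1"
      using u(1) by (intro mult_left_mono) auto
    hence "\<rho> \<le> 1 - (norm u)\<^sup>2"
      using u(2) by (simp add: power2_eq_square)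
    hence "\<rho> * norm (deriv g u) \<le> (1 - (norm u)\<^sup>2) * norm (deriv g u)"
      by (intro mult_right_mono) auto
    also have "\<dots> \<le> M"
      by (rule M[OF u(1)])
    finally show "norm (deriv g u) \<le> M / \<rho>"
      using \<rho> by (simp add: field_simps)
  qed (use \<rho> in auto)
  also have "\<dots> = 4 * M / (1 - norm w)\<^sup>2"
    by (simp add: \<rho>_def power2_eq_square)
  finally show ?thesis by simp
qed

text \<open>The bounds are explicit and linear in \<open>F\<close>, so that taking \<open>F\<close>
  to be the sup norm of f yields an operator bound with a constant depending only on g.\<close>

lemma hilbert_op_bloch_bounds:
  assumes g: "g holomorphic_on \<bbbD>"
    and M: "\<And>z. z \<in> \<bbbD> \<Longrightarrow> (1 - (norm z)\<^sup>2) * norm (deriv g z) \<le> M"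
    and f: "f holomorphic_on \<bbbD>" and F: "\<And>z. z \<in> \<bbbD> \<Longrightarrow> norm (f z) \<le> F"
  shows "hilbert_op g f holomorphic_on \<bbbD>"
    and "norm (hilbert_op g f 0) \<le> M * F"
    and "\<And>z. z \<in> \<bbbD> \<Longrightarrow> (1 - (norm z)\<^sup>2) * norm (deriv (hilbert_op g f) z) \<le> 8 * M * F"
proof -
  have F0: "0 \<le> F"
    using order_trans[OF norm_ge_zero F[of 0]] by simp
  have M0: "0 \<le> M"
    using order_trans[OF norm_ge_zero[of "deriv g 0"]] M[of 0] by simp
  have contf: "continuous_on {0..<1::real} (\<lambda>t. f (of_real t))"
    by (rule continuous_on_compose2[OF holomorphic_on_imp_continuous_on[OF f]])
       (auto intro!: continuous_intros)
  have bdf: "norm (f (of_real t)) \<le> F" if "t \<in> {0..<1}" for t :: real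
    using that by (intro F) auto
  have hol: "deriv g holomorphic_on \<bbbD>" "deriv (deriv g) holomorphic_on \<bbbD>"
    by (intro holomorphic_deriv g open_ball)+
  have deriv: "(hilbert_op g f has_field_derivative
      (LINT t:{0..<1}|lborel. f (of_real t) * of_real t * deriv (deriv g) (of_real t * z))) (at z)"
    if "z \<in> \<bbbD>" for z
    using has_field_derivative_weighted_dilation[OF contf bdf hol(1) that]
    by (simp add: hilbert_op_def[abs_def])
  show "hilbert_op g f holomorphic_on \<bbbD>"
    using deriv unfolding holomorphic_on_open[OF open_ball] by blast
  \<comment> \<open>At the origin the kernel is the constant g'(0), and the Bloch condition at 0
    reads |g'(0)| \<le> M.\<close>
  have "norm (LINT t:{0..<1::real}|lborel. f (of_real t) * deriv g (of_real t * 0)) \<le> M * F"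
  proof (rule norm_set_integral_le_const)
    show "set_integrable lborel {0..<1::real} (\<lambda>t. f (of_real t) * deriv g (of_real t * 0))"
      by (rule set_integrable_weighted_dilation[OF contf bdf
            holomorphic_on_imp_continuous_on[OF hol(1)]]) auto
    show "norm (f (of_real t) * deriv g (of_real t * 0)) \<le> M * F" if "t \<in> {0..<1}" for t :: real
      using mult_mono[OF bdf[OF that], of "norm (deriv g 0)" M] M[of 0] F0
      by (simp add: norm_mult mult.commute)
  qed
  thus "norm (hilbert_op g f 0) \<le> M * F"
    by (simp add: hilbert_op_def)
  fix z :: complex assume z: "z \<in> \<bbbD>"
  define r where "r = norm z"
  have r: "0 \<le> r" "r < 1"
    using z by (auto simp: r_def)
  have pos: "0 < 1 - t * r" if "0 \<le> t" "t \<le> 1" for t :: real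
    using mult_left_le_one_le[of r t] that r by simp
  have "norm (deriv (hilbert_op g f) z) =
      norm (LINT t:{0..<1}|lborel. f (of_real t) * of_real t * deriv (deriv g) (of_real t * z))"
    using DERIV_imp_deriv[OF deriv[OF z]] by simp
  \<comment> \<open>The antiderivative t/(1 - tr) of (1 - tr)^(-2) involves no division by r, so z =
    0 needs no separate case. It vanishes at t = 0 and equals 1/(1 - r) at t = 1.\<close>
  also have "\<dots> \<le> 4 * M * F * (1 / (1 - 1 * r)) - 4 * M * F * (0 / (1 - 0 * r))"
  proof (rule norm_set_integral_le_antiderivative
      [where b = "\<lambda>t. 4 * M * F / (1 - t * r)\<^sup>2" and B = "\<lambda>t. 4 * M * F * (t / (1 - t * r))"])
    have tf: "norm (f (of_real t) * of_real t) \<le> F" if "t \<in> {0..<1}" for t :: real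
      using mult_mono[OF bdf[OF that], of "\<bar>t\<bar>" 1] that F0 by (simp add: norm_mult)
    show "set_integrable lborel {0..<1}
        (\<lambda>t. f (of_real t) * of_real t * deriv (deriv g) (of_real t * z))"
      by (rule set_integrable_weighted_dilation[OF _ tf
            holomorphic_on_imp_continuous_on[OF hol(2)] z])
         (intro continuous_intros contf)
    fix t :: real assume t: "t \<in> {0..<1}"
    have "of_real t * z \<in> \<bbbD>"
      using norm_of_real_mult_le[of t z] t z by auto
    hence "norm (deriv (deriv g) (of_real t * z)) \<le> 4 * M / (1 - t * r)\<^sup>2"
      using bloch_second_deriv_bound[OF g M, of "of_real t * z"] t
      by (simp add: norm_mult r_def)
    hence "norm (f (of_real t) * of_real t) * norm (deriv (deriv g) (of_real t * z))
        \<le> F * (4 * M / (1 - t * r)\<^sup>2)"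
      by (intro mult_mono tf t F0) auto
    thus "norm (f (of_real t) * of_real t * deriv (deriv g) (of_real t * z))
        \<le> 4 * M * F / (1 - t * r)\<^sup>2"
      by (simp add: norm_mult mult_ac)
  next
    fix t :: real assume t: "t \<in> {0..1}"
    show "((\<lambda>t. 4 * M * F * (t / (1 - t * r))) has_real_derivative 4 * M * F / (1 - t * r)\<^sup>2)
        (at t within {0..1})"
      using pos[of t] t
      by (auto intro!: derivative_eq_intros simp: power2_eq_square field_simps)
  next
    show "continuous_on {0..1} (\<lambda>t. 4 * M * F / (1 - t * r)\<^sup>2)"
      by (intro continuous_intros) (use pos in force)
  qed
  finally have "norm (deriv (hilbert_op g f) z) \<le> 4 * M * F / (1 - r)"
    by simp
  hence "(1 - r\<^sup>2) * norm (deriv (hilbert_op g f) z) \<le> (1 - r\<^sup>2) * (4 * M * F / (1 - r))"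
    using r by (intro mult_left_mono) (auto simp: power_le_one)
  \<comment> \<open>The Bloch weight factors as (1 - r)(1 + r) and cancels the singularity; 1 + r
    \<le> 2 then turns 4 into 8.\<close>
  also have "\<dots> = (1 + r) * (4 * M * F)"
    using r by (simp add: power2_eq_square field_simps)
  also have "\<dots> \<le> 2 * (4 * M * F)"
    using r M0 F0 by (intro mult_right_mono) auto
  finally show "(1 - (norm z)\<^sup>2) * norm (deriv (hilbert_op g f) z) \<le> 8 * M * F"
    by (simp add: r_def)
qed

section \<open>Recovering the symbol from the image of the constant function\<close>

text \<open>The function z g'(tz) is the derivative of g(tz) with respect to t. Keeping the factor z
  on the left avoids a division at z = 0.\<close>

lemma hilbert_op_one:
  assumes g: "g holomorphic_on \<bbbD>" and z: "z \<in> \<bbbD>"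
  shows "z * hilbert_op g (\<lambda>_. 1) z = g z - g 0"
proof -
  have tz: "of_real t * z \<in> \<bbbD>" if "t \<in> {0..1}" for t
    using norm_of_real_mult_le[of t z] that z by auto
  \<comment> \<open>Here the endpoint t = 1 can be added, since z itself lies in the open disc and
    the integrand is continuous there.\<close>
  have "(LINT t:{0..<1}|lborel. z * deriv g (of_real t * z))
      = (LINT t:{0..1}|lborel. z * deriv g (of_real t * z))"
    by (rule set_integral_discrete_difference[where X = "{1}"]) auto
  also have "\<dots> = g (of_real 1 * z) - g (of_real 0 * z)"
    unfolding set_lebesgue_integral_def
  proof (rule integral_FTC_Icc)
    fix t :: real assume "0 \<le> t" "t \<le> 1"
    hence "(g has_field_derivative deriv g (of_real t * z)) (at (of_real t * z))"
      using holomorphic_derivI[OF g open_ball tz] by auto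
    moreover have "((\<lambda>t. of_real t * z) has_vector_derivative z) (at t within {0..1})"
      by (auto intro!: derivative_eq_intros)
    ultimately show "((\<lambda>t. g (of_real t * z)) has_vector_derivative z * deriv g (of_real t * z))
        (at t within {0..1})"
      using field_vector_diff_chain_within[of "\<lambda>t. of_real t * z" z t "{0..1}" g]
      by (auto simp: o_def intro: DERIV_subset)
  next
    have "continuous_on \<bbbD> (deriv g)"
      by (intro holomorphic_on_imp_continuous_on holomorphic_deriv g open_ball)
    hence "continuous_on {0..1} (\<lambda>t. deriv g (of_real t * z))"
      by (rule continuous_on_compose2) (use tz in \<open>auto intro!: continuous_intros\<close>)
    thus "continuous_on {0..1} (\<lambda>t. z * deriv g (of_real t * z))"
      by (rule continuous_on_mult_left)
  qed auto
  finally show ?thesis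
    by (simp add: hilbert_op_def)
qed

text \<open>On the disc of radius |z| the weight is smallest on the boundary, so |h'| \<le> M/(1 -
  |z|^2) there, and the mean value inequality from 0 to z gives the bound. It controls the
  undifferentiated term in the product rule for z h(z).\<close>

lemma bloch_space_growth:
  assumes h: "h holomorphic_on \<bbbD>"
    and M: "\<And>z. z \<in> \<bbbD> \<Longrightarrow> (1 - (norm z)\<^sup>2) * norm (deriv h z) \<le> M"
    and z: "z \<in> \<bbbD>"
  shows "(1 - (norm z)\<^sup>2) * norm (h z) \<le> norm (h 0) + M"
proof -
  define c where "c = 1 - (norm z)\<^sup>2"
  have c: "0 < c" "c \<le> 1"
    using z by (auto simp: c_def power_less_one_iff abs_square_less_1)
  have M0: "0 \<le> M"
    using M[of 0] by (auto intro: order_trans[OF norm_ge_zero])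
  have "norm (h z - h 0) \<le> M / c * norm (z - 0)"
  proof (rule field_differentiable_bound[of "cball 0 (norm z)"])
    fix w :: complex assume w: "w \<in> cball 0 (norm z)"
    hence wD: "w \<in> \<bbbD>" using z by auto
    show "(h has_field_derivative deriv h w) (at w within cball 0 (norm z))"
      by (rule holomorphic_derivI[OF h open_ball wD])
    have "c * norm (deriv h w) \<le> (1 - (norm w)\<^sup>2) * norm (deriv h w)"
      using w by (intro mult_right_mono) (auto simp: c_def power_mono)
    also have "\<dots> \<le> M"
      by (rule M[OF wD])
    finally show "norm (deriv h w) \<le> M / c"
      using c by (simp add: field_simps)
  qed auto
  also have "\<dots> \<le> M / c * 1"
    using z M0 c by (intro mult_left_mono) auto
  finally have "c * norm (h z - h 0) \<le> M"
    using c by (simp add: field_simps)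
  moreover have "c * norm (h z) \<le> c * (norm (h 0) + norm (h z - h 0))"
    using c by (intro mult_left_mono) (auto intro: norm_triangle_sub)
  moreover have "c * norm (h 0) \<le> norm (h 0)"
    using c by (simp add: mult_left_le_one_le)
  ultimately show ?thesis
    by (simp add: c_def[symmetric] distrib_left)
qed

text \<open>On the disc g' = h + z h'. After weighting, the first term is bounded by
  \<open>bloch_space_growth\<close> and the second by the Bloch condition on h, because |z| <
  1.\<close>

lemma bloch_space_mult_id:
  assumes h: "h \<in> bloch_space"
    and g: "g holomorphic_on \<bbbD>" and eq: "\<And>z. z \<in> \<bbbD> \<Longrightarrow> z * h z = g z - g 0"
  shows "g \<in> bloch_space"
proof -
  have hol: "h holomorphic_on \<bbbD>"
    using h by (simp add: bloch_space_def)
  obtain M where M: "\<And>z. z \<in> \<bbbD> \<Longrightarrow> (1 - (norm z)\<^sup>2) * norm (deriv h z) \<le> M"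
    using h unfolding bloch_space_def bdd_above_def by blast
  have "(1 - (norm z)\<^sup>2) * norm (deriv g z) \<le> norm (h 0) + M + M" if z: "z \<in> \<bbbD>" for z
  proof -
    define c where "c = 1 - (norm z)\<^sup>2"
    have c: "0 \<le> c"
      using z by (auto simp: c_def power_le_one)
    have "((\<lambda>z. z * h z + g 0) has_field_derivative h z + z * deriv h z) (at z)"
      using holomorphic_derivI[OF hol open_ball z]
      by (auto intro!: derivative_eq_intros)
    hence "(g has_field_derivative h z + z * deriv h z) (at z)"
      by (rule has_field_derivative_transform_within_open[OF _ open_ball z]) (simp add: eq)
    hence "c * norm (deriv g z) = c * norm (h z + z * deriv h z)"
      by (simp add: DERIV_imp_deriv)
    also have "\<dots> \<le> c * (norm (h z) + norm (z * deriv h z))"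
      by (intro mult_left_mono norm_triangle_ineq c)
    also have "norm (z * deriv h z) \<le> norm (deriv h z)"
      using z by (simp add: norm_mult mult_left_le_one_le)
    hence "c * (norm (h z) + norm (z * deriv h z)) \<le> c * norm (h z) + c * norm (deriv h z)"
      using c by (simp add: mult_left_mono flip: distrib_left)
    also have "\<dots> \<le> norm (h 0) + M + M"
      using M[OF z] bloch_space_growth[OF hol M z] by (simp add: c_def)
    finally show ?thesis
      by (simp add: c_def)
  qed
  thus ?thesis
    using g by (auto simp: bloch_space_def intro!: bdd_aboveI2)
qed

theorem theorem3p5:
  fixes g :: "complex \<Rightarrow> complex"
  assumes "g holomorphic_on \<bbbD>"
  shows "bounded_operator H_infty H_infty_norm bloch_space bloch_norm (hilbert_op g)
           \<longleftrightarrow> g \<in> bloch_space"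
proof
  assume "bounded_operator H_infty H_infty_norm bloch_space bloch_norm (hilbert_op g)"
  \<comment> \<open>The constant function 1 is the test function: its image under the operator
    determines g up to the constant g(0).\<close>
  moreover have "(\<lambda>_. 1) \<in> H_infty"
    by (auto simp: H_infty_def bounded_iff)
  ultimately have "hilbert_op g (\<lambda>_. 1) \<in> bloch_space"
    unfolding bounded_operator_def by blast
  thus "g \<in> bloch_space"
    by (rule bloch_space_mult_id[OF _ assms hilbert_op_one[OF assms]])
next
  assume "g \<in> bloch_space"
  then obtain M where M: "\<And>z. z \<in> \<bbbD> \<Longrightarrow> (1 - (norm z)\<^sup>2) * norm (deriv g z) \<le> M"
    unfolding bloch_space_def bdd_above_def by blast
  \<comment> \<open>9 = 1 + 8: one M from the value at the origin and 8 M from the weighted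
    derivative.\<close>
  have "hilbert_op g f \<in> bloch_space \<and> bloch_norm (hilbert_op g f) \<le> 9 * M * H_infty_norm f"
    if f: "f \<in> H_infty" for f
  proof -
    have hol: "f holomorphic_on \<bbbD>" and bdd: "bdd_above ((\<lambda>z. norm (f z)) ` \<bbbD>)"
      using f by (auto simp: H_infty_def bounded_iff bdd_above_def)
    \<comment> \<open>Boundedness of f makes the real supremum a genuine upper bound.\<close>
    have F: "norm (f z) \<le> H_infty_norm f" if "z \<in> \<bbbD>" for z
      unfolding H_infty_norm_def by (rule cSUP_upper[OF that bdd])
    note H = hilbert_op_bloch_bounds[OF assms M hol F]
    have "hilbert_op g f \<in> bloch_space"
      using H(1,3) by (auto simp: bloch_space_def intro!: bdd_aboveI2)
    moreover have "(SUP z\<in>\<bbbD>. (1 - (norm z)\<^sup>2) * norm (deriv (hilbert_op g f) z))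
        \<le> 8 * M * H_infty_norm f"
      by (rule cSUP_least) (use H(3) in auto)
    ultimately show ?thesis
      using H(2) by (simp add: bloch_norm_def)
  qed
  thus "bounded_operator H_infty H_infty_norm bloch_space bloch_norm (hilbert_op g)"
    unfolding bounded_operator_def by blast
qed

end
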